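(* Let $d\ge1$ and let $f(\mu,\Sigma)=\begin{bmatrix}\Sigma+\mu\mu^\top&\mu\\ \mu^\top&1\end{bmatrix}$ for $\mu\in\mathbb{R}^d$ and $\Sigma$ a real symmetric positive-definite $d\times d$ matrix. (1) The mixture geodesics are preserved by the embedding $f$: for all $d$-variate normal distributions $N_1=N(\mu_1,\Sigma_1)$, $N_2=N(\mu_2,\Sigma_2)$ and all $t\in[0,1]$, $$f\big(\gamma^m_{\mathcal{N}}(N_1,N_2;t)\big)=\gamma^m_{\mathcal{P}}\big(f(N_1),f(N_2);t\big).$$ (2) The exponential geodesics are preserved on the subspace of normal distributions with a fixed mean: for every $\mu\in\mathbb{R}^d$, all $N_1=N(\mu,\Sigma_1)$, $N_2=N(\mu,\Sigma_2)$ and all $t\in[0,1]$, $$f\big(\gamma^e_{\mathcal{N}}(N_1,N_2;t)\big)=\gamma^e_{\mathcal{P}}\big(f(N_1),f(N_2);t\big).$$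
   Context: A normal distribution $N(\mu,\Sigma)$ is identified with its parameters $(\mu,\Sigma)$, and $f(N)=f(\mu,\Sigma)$, which is a symmetric positive-definite $(d+1)\times(d+1)$ matrix, viewed as the covariance matrix of a centered $(d+1)$-variate normal distribution. The mixture geodesic (linear interpolation in the moment parameters) between $N_1=N(\mu_1,\Sigma_1)$ and $N_2=N(\mu_2,\Sigma_2)$ is $\gamma^m_{\mathcal{N}}(N_1,N_2;t)=(\mu^m_t,\Sigma^m_t)$ with $\mu^m_t=\bar\mu_t:=t\mu_1+(1-t)\mu_2$ and $$\Sigma^m_t=t\Sigma_1+(1-t)\Sigma_2+t\mu_1\mu_1^\top+(1-t)\mu_2\mu_2^\top-\bar\mu_t\bar\mu_t^\top.$$ The exponential geodesic (linear interpolation in the natural parameters $(\Sigma^{-1}\mu,\frac12\Sigma^{-1})$) is $\gamma^e_{\mathcal{N}}(N_1,N_2;t)=(\mu^e_t,\Sigma^e_t)$ with $$\Sigma^e_t=\big(t\Sigma_1^{-1}+(1-t)\Sigma_2^{-1}\big)^{-1},\qquad \mu^e_t=\Sigma^e_t\big(t\Sigma_1^{-1}\mu_1+(1-t)\Sigma_2^{-1}\mu_2\big).$$ On the cone $\mathcal{P}$ of symmetric positive-definite $(d+1)\times(d+1)$ matrices (viewed as centered normal distributions), the mixture and exponential geodesics are the corresponding curves with zero means: $\gamma^m_{\mathcal{P}}(P_1,P_2;t)=tP_1+(1-t)P_2$ and $\gamma^e_{\mathcal{P}}(P_1,P_2;t)=\big(tP_1^{-1}+(1-t)P_2^{-1}\big)^{-1}$.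 *)

theory Defs
  imports "HOL-Analysis.Analysis"
begin

definition spd_matrices :: "(real^'n^'n) set" where
  "spd_matrices = {A. transpose A = A \<and> (\<forall>x. x \<noteq> 0 \<longrightarrow> 0 < x \<bullet> (A *v x))}"

text \<open>A normal distribution is identified with its pair of mean vector and covariance matrix.\<close>

definition normal_params :: "((real^'n) \<times> (real^'n^'n)) set" where
  "normal_params = UNIV \<times> spd_matrices"

definition outer :: "real^'n \<Rightarrow> real^'n^'n" where
  "outer x = (\<chi> i j. x $ i * x $ j)"

text \<open>The index type \<open>'n + 1\<close> has one element more than \<open>'n\<close>: \<open>Inl i\<close> are the original
  indices, \<open>Inr _\<close> is the additional last one.\<close>

definition normal_embed :: "(real^'n) \<times> (real^'n^'n) \<Rightarrow> real^('n + 1)^('n + 1)" where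
  "normal_embed N = (case N of (\<mu>, \<Sigma>) \<Rightarrow>
     (\<chi> i j. case i of
        Inl k \<Rightarrow> (case j of Inl l \<Rightarrow> (\<Sigma> + outer \<mu>) $ k $ l | Inr _ \<Rightarrow> \<mu> $ k)
      | Inr _ \<Rightarrow> (case j of Inl l \<Rightarrow> \<mu> $ l | Inr _ \<Rightarrow> 1)))"

text \<open>In all four curves the parameter value \<open>t = 1\<close> gives the first point and \<open>t = 0\<close> the second.\<close>

definition mixture_geodesic ::
  "(real^'n) \<times> (real^'n^'n) \<Rightarrow> (real^'n) \<times> (real^'n^'n) \<Rightarrow> real \<Rightarrow> (real^'n) \<times> (real^'n^'n)" where
  "mixture_geodesic N1 N2 t = (case N1 of (\<mu>1, \<Sigma>1) \<Rightarrow> case N2 of (\<mu>2, \<Sigma>2) \<Rightarrow>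
     let \<mu> = t *\<^sub>R \<mu>1 + (1 - t) *\<^sub>R \<mu>2
     in (\<mu>, t *\<^sub>R \<Sigma>1 + (1 - t) *\<^sub>R \<Sigma>2 + t *\<^sub>R outer \<mu>1 + (1 - t) *\<^sub>R outer \<mu>2 - outer \<mu>))"

definition exponential_geodesic ::
  "(real^'n) \<times> (real^'n^'n) \<Rightarrow> (real^'n) \<times> (real^'n^'n) \<Rightarrow> real \<Rightarrow> (real^'n) \<times> (real^'n^'n)" where
  "exponential_geodesic N1 N2 t = (case N1 of (\<mu>1, \<Sigma>1) \<Rightarrow> case N2 of (\<mu>2, \<Sigma>2) \<Rightarrow>
     let \<Sigma> = matrix_inv (t *\<^sub>R matrix_inv \<Sigma>1 + (1 - t) *\<^sub>R matrix_inv \<Sigma>2)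
     in (\<Sigma> *v (t *\<^sub>R (matrix_inv \<Sigma>1 *v \<mu>1) + (1 - t) *\<^sub>R (matrix_inv \<Sigma>2 *v \<mu>2)), \<Sigma>))"

definition cone_mixture_geodesic ::
  "real^'m^'m \<Rightarrow> real^'m^'m \<Rightarrow> real \<Rightarrow> real^'m^'m" where
  "cone_mixture_geodesic P1 P2 t = t *\<^sub>R P1 + (1 - t) *\<^sub>R P2"

definition cone_exponential_geodesic ::
  "real^'m^'m \<Rightarrow> real^'m^'m \<Rightarrow> real \<Rightarrow> real^'m^'m" where
  "cone_exponential_geodesic P1 P2 t =
     matrix_inv (t *\<^sub>R matrix_inv P1 + (1 - t) *\<^sub>R matrix_inv P2)"

lemma mixture_geodesic_centered:
  "mixture_geodesic (0, P1) (0, P2) t = (0, cone_mixture_geodesic P1 P2 t)"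
  by (simp add: mixture_geodesic_def cone_mixture_geodesic_def outer_def vec_eq_iff)

lemma exponential_geodesic_centered:
  "exponential_geodesic (0, P1) (0, P2) t = (0, cone_exponential_geodesic P1 P2 t)"
  by (simp add: exponential_geodesic_def cone_exponential_geodesic_def Let_def)

lemma normal_embed_quadratic_form:
  fixes \<mu> :: "real^'n" and \<Sigma> :: "real^'n^'n" and x :: "real^('n + 1)"
  defines "y \<equiv> (\<chi> k. x $ Inl k)" and "s \<equiv> x $ Inr 1"
  shows "x \<bullet> (normal_embed (\<mu>, \<Sigma>) *v x) = y \<bullet> (\<Sigma> *v y) + (y \<bullet> \<mu> + s)\<^sup>2"
proof -
  have U: "(UNIV :: ('n + 1) set) = range Inl \<union> {Inr 1}"
  proof -
    have "z \<in> range Inl \<union> {Inr 1}" for z :: "'n + 1" by (cases z) auto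
    then show ?thesis by blast
  qed
  have S: "(\<Sum>i\<in>UNIV. g i) = (\<Sum>k\<in>UNIV. g (Inl k)) + g (Inr 1)" for g :: "'n + 1 \<Rightarrow> real"
    unfolding U by (subst sum.union_disjoint) (auto simp: sum.reindex)
  have "(\<Sum>k\<in>UNIV. \<Sum>l\<in>UNIV. y $ k * (\<mu> $ k * \<mu> $ l * y $ l)) = (y \<bullet> \<mu>)\<^sup>2"
    by (simp add: inner_vec_def power2_eq_square sum_product ac_simps)
  moreover have "y \<bullet> (\<Sigma> *v y) = (\<Sum>k\<in>UNIV. \<Sum>l\<in>UNIV. y $ k * (\<Sigma> $ k $ l * y $ l))"
    by (simp add: inner_vec_def matrix_vector_mult_def sum_distrib_left)
  moreover have "(\<Sum>k\<in>UNIV. y $ k * (\<mu> $ k * s)) = (y \<bullet> \<mu>) * s"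
    by (simp add: inner_vec_def sum_distrib_left ac_simps)
  moreover have "s * (\<Sum>l\<in>UNIV. \<mu> $ l * y $ l) = (y \<bullet> \<mu>) * s"
    by (simp add: inner_vec_def sum_distrib_left ac_simps)
  moreover have "x \<bullet> (normal_embed (\<mu>, \<Sigma>) *v x) =
      (\<Sum>k\<in>UNIV. \<Sum>l\<in>UNIV. y $ k * (\<Sigma> $ k $ l * y $ l))
    + (\<Sum>k\<in>UNIV. \<Sum>l\<in>UNIV. y $ k * (\<mu> $ k * \<mu> $ l * y $ l))
    + (\<Sum>k\<in>UNIV. y $ k * (\<mu> $ k * s)) + s * (\<Sum>l\<in>UNIV. \<mu> $ l * y $ l) + s * s"
    by (simp add: inner_vec_def matrix_vector_mult_def normal_embed_def outer_def S y_def s_def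
        algebra_simps sum.distrib sum_distrib_left)
  ultimately show ?thesis
    by (simp add: power2_eq_square algebra_simps)
qed

lemma normal_embed_in_spd_matrices:
  assumes "N \<in> normal_params"
  shows "normal_embed N \<in> spd_matrices"
proof -
  obtain \<mu> \<Sigma> where N: "N = (\<mu>, \<Sigma>)" by (cases N)
  have sym: "transpose \<Sigma> = \<Sigma>" and pos: "\<And>y. y \<noteq> 0 \<Longrightarrow> 0 < y \<bullet> (\<Sigma> *v y)"
    using assms by (auto simp: N normal_params_def spd_matrices_def)
  have sym': "\<Sigma> $ i $ j = \<Sigma> $ j $ i" for i j
    using sym by (metis transpose_def vec_lambda_beta)
  have "transpose (normal_embed N) = normal_embed N"
    by (auto simp: N transpose_def normal_embed_def outer_def vec_eq_iff sym' mult.commute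
        split: sum.splits)
  moreover have "0 < x \<bullet> (normal_embed N *v x)" if "x \<noteq> 0" for x
  proof (cases "(\<chi> k. x $ Inl k) = 0")
    case True
    have "x $ Inr 1 \<noteq> 0"
    proof
      assume "x $ Inr 1 = 0"
      then have "x $ i = 0" for i
        using True by (cases i) (auto simp: vec_eq_iff, metis num1_eq1)
      with that show False by (simp add: vec_eq_iff)
    qed
    then show ?thesis unfolding N normal_embed_quadratic_form True by simp
  next
    case False
    then show ?thesis unfolding N normal_embed_quadratic_form
      by (intro add_pos_nonneg pos) auto
  qed
  ultimately show ?thesis by (simp add: spd_matrices_def)
qed

end

theory Submission
  imports Defs
begin

text \<open>The embedding \<open>f\<close> is affine in the moment parameters, which gives the first part. For the
  second part, \<open>f(\<mu>, \<Sigma>)\<^sup>-\<^sup>1\<close> is the block matrix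
  \<open>[A, - A \<mu>; - \<mu>\<^sup>T A, \<mu>\<^sup>T A \<mu> + 1]\<close> with \<open>A = \<Sigma>\<^sup>-\<^sup>1\<close>. For a fixed \<open>\<mu>\<close> it is affine in \<open>A\<close>, and the
  mean is constant along the exponential geodesic.\<close>

text \<open>The last row uses \<open>\<mu> v* A\<close> rather than \<open>A *v \<mu>\<close>, so
  the block formula inverts \<open>normal_embed\<close> for any right inverse \<open>A\<close> of
  \<open>\<Sigma>\<close>, with no symmetry required of \<open>A\<close>.\<close>

definition precision_embed :: "real^'n \<Rightarrow> real^'n^'n \<Rightarrow> real^('n + 1)^('n + 1)" where
  "precision_embed \<mu> A = (\<chi> i j. case i of
        Inl k \<Rightarrow> (case j of Inl l \<Rightarrow> A $ k $ l | Inr _ \<Rightarrow> - (A *v \<mu>) $ k)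
      | Inr _ \<Rightarrow> (case j of Inl l \<Rightarrow> - (\<mu> v* A) $ l | Inr _ \<Rightarrow> \<mu> \<bullet> (A *v \<mu>) + 1))"

lemma sum_UNIV_plus_num1:
  fixes g :: "'n::finite + 1 \<Rightarrow> 'a::comm_monoid_add"
  shows "(\<Sum>i\<in>UNIV. g i) = (\<Sum>k\<in>UNIV. g (Inl k)) + g (Inr 1)"
  by (simp add: UNIV_Plus_UNIV[symmetric] sum.Plus del: UNIV_Plus_UNIV)

lemma matrix_inv_mult:
  assumes "invertible A"
  shows matrix_inv_right: "A ** matrix_inv A = mat 1"
    and matrix_inv_left: "matrix_inv A ** A = mat 1"
  using someI_ex[OF assms[unfolded invertible_def]] by (auto simp: matrix_inv_def)

text \<open>A right inverse of a square real matrix is two-sided, so one product identity determines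
  \<open>matrix_inv\<close>.\<close>

lemma matrix_inv_eqI:
  fixes A B :: "real^'n^'n"
  assumes "A ** B = mat 1"
  shows "matrix_inv A = B"
proof -
  have "invertible A"
    using assms assms[THEN matrix_left_right_inverse[THEN iffD1]] unfolding invertible_def by blast
  then have "matrix_inv A ** (A ** B) = B"
    by (simp add: matrix_mul_assoc matrix_inv_left)
  then show ?thesis by (simp add: assms)
qed

lemma spd_matrices_invertible:
  assumes "A \<in> spd_matrices"
  shows "invertible A"
proof -
  have "x = 0" if "A *v x = 0" for x
    using assms that by (force simp: spd_matrices_def)
  then show ?thesis
    by (simp add: invertible_left_inverse matrix_left_invertible_ker)
qed

lemma spd_matrices_matrix_inv:
  fixes A :: "real^'n^'n"
  assumes "A \<in> spd_matrices"
  shows "matrix_inv A \<in> spd_matrices"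
proof -
  define B where "B = matrix_inv A"
  have inv: "A ** B = mat 1" "B ** A = mat 1"
    using spd_matrices_invertible[OF assms]
    by (simp_all add: B_def matrix_inv_left matrix_inv_right)
  have sym: "transpose A = A" and pos: "\<And>x. x \<noteq> 0 \<Longrightarrow> 0 < x \<bullet> (A *v x)"
    using assms by (auto simp: spd_matrices_def)
  \<comment> \<open>Transposing \<open>B ** A = mat 1\<close> makes \<open>transpose B\<close>
    another right inverse of the symmetric \<open>A\<close>; uniqueness gives symmetry of
    \<open>B\<close>.\<close>
  have "A ** transpose B = mat 1"
    using inv(2) sym by (metis matrix_transpose_mul transpose_mat)
  then have "transpose B = B"
    using matrix_inv_eqI B_def by metis
  moreover have "0 < x \<bullet> (B *v x)" if "x \<noteq> 0" for x
  proof -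
    \<comment> \<open>Substituting \<open>x = A *v (B *v x)\<close> turns the form of
      \<open>B\<close> at \<open>x\<close> into the form of \<open>A\<close> at
      \<open>B *v x\<close>.\<close>
    have x: "A *v (B *v x) = x"
      by (simp add: matrix_vector_mul_assoc inv)
    with that have "B *v x \<noteq> 0" by auto
    from pos[OF this] show ?thesis by (simp add: x inner_commute)
  qed
  ultimately show ?thesis by (simp add: spd_matrices_def B_def)
qed

lemma spd_matrices_convex: "convex spd_matrices"
proof (rule convexI)
  fix A B :: "real^'n^'n" and u v :: real
  assume A: "A \<in> spd_matrices" and B: "B \<in> spd_matrices"
    and uv: "0 \<le> u" "0 \<le> v" "u + v = 1"
  have "transpose (u *\<^sub>R A + v *\<^sub>R B) = u *\<^sub>R A + v *\<^sub>R B"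
    using A B by (simp add: spd_matrices_def transpose_def vec_eq_iff)
  moreover have "0 < x \<bullet> ((u *\<^sub>R A + v *\<^sub>R B) *v x)" if "x \<noteq> 0" for x
  proof -
    have "0 < x \<bullet> (A *v x)" "0 < x \<bullet> (B *v x)"
      using A B that by (auto simp: spd_matrices_def)
    with uv have "0 < u * (x \<bullet> (A *v x)) + v * (x \<bullet> (B *v x))"
      \<comment> \<open>If \<open>u = 0\<close> then \<open>v = 1\<close>; otherwise the first
        summand is already positive.\<close>
      by (cases "u = 0") (auto intro!: add_pos_nonneg)
    then show ?thesis
      by (simp add: matrix_vector_mult_add_rdistrib scaleR_matrix_vector_assoc[symmetric]
          inner_add_right)
  qed
  ultimately show "u *\<^sub>R A + v *\<^sub>R B \<in> spd_matrices"
    by (simp add: spd_matrices_def)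
qed

text \<open>Block multiplication: the rank-one part of \<open>\<Sigma> + outer \<mu>\<close>
  produces multiples of \<open>\<mu>\<close> that the extra index cancels.\<close>

lemma normal_embed_mult_precision_embed:
  fixes \<mu> :: "real^'n"
  assumes "\<Sigma> ** A = mat 1"
  shows "normal_embed (\<mu>, \<Sigma>) ** precision_embed \<mu> A = mat 1"
proof -
  have 1: "(\<Sum>m\<in>UNIV. \<Sigma> $ k $ m * A $ m $ l) = (if k = l then 1 else 0)" for k l
    using assms by (simp add: matrix_matrix_mult_def mat_def vec_eq_iff)
  have 2: "(\<Sum>m\<in>UNIV. \<mu> $ m * A $ m $ l) = (\<mu> v* A) $ l" for l
    by (simp add: vector_matrix_mult_def mult.commute)
  have 3: "(\<Sum>m\<in>UNIV. \<mu> $ m * (A *v \<mu>) $ m) = \<mu> \<bullet> (A *v \<mu>)"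
    by (simp add: inner_vec_def)
  have 4: "(\<Sum>m\<in>UNIV. \<Sigma> $ k $ m * (A *v \<mu>) $ m) = \<mu> $ k" for k
  proof -
    have "\<Sigma> *v (A *v \<mu>) = \<mu>" by (simp add: matrix_vector_mul_assoc assms)
    then show ?thesis by (simp add: matrix_vector_mult_def[of \<Sigma>] vec_eq_iff)
  qed
  \<comment> \<open>\<open>ll\<close> and \<open>lr\<close> collect the \<open>Inl\<close> summands
    of the two upper blocks, \<open>lr\<close> up to sign.\<close>
  have ll: "(\<Sum>m\<in>UNIV. (\<Sigma> $ k $ m + \<mu> $ k * \<mu> $ m) * A $ m $ l) =
      (if k = l then 1 else 0) + \<mu> $ k * (\<mu> v* A) $ l" for k l
    by (simp add: distrib_right sum.distrib 1 mult.assoc 2 flip: sum_distrib_left)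
  have lr: "(\<Sum>m\<in>UNIV. (\<Sigma> $ k $ m + \<mu> $ k * \<mu> $ m) * (A *v \<mu>) $ m) =
      \<mu> $ k + \<mu> $ k * (\<mu> \<bullet> (A *v \<mu>))" for k
    by (simp add: distrib_right sum.distrib 4 mult.assoc 3 flip: sum_distrib_left)
  show ?thesis
    by (auto simp: vec_eq_iff matrix_matrix_mult_def sum_UNIV_plus_num1 normal_embed_def
        precision_embed_def outer_def mat_def sum_negf ll lr 2 3 distrib_left split: sum.splits)
qed

text \<open>The constant 1 in the corner survives because the weights sum to 1.\<close>

lemma precision_embed_affine:
  "precision_embed \<mu> (t *\<^sub>R A + (1 - t) *\<^sub>R B) =
    t *\<^sub>R precision_embed \<mu> A + (1 - t) *\<^sub>R precision_embed \<mu> B"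
  by (auto simp: precision_embed_def vec_eq_iff vector_matrix_mult_def matrix_vector_mult_def
      inner_vec_def sum.distrib sum_distrib_left sum_subtractf algebra_simps split: sum.splits)

lemma matrix_inv_normal_embed:
  assumes "\<Sigma> \<in> spd_matrices"
  shows "matrix_inv (normal_embed (\<mu>, \<Sigma>)) = precision_embed \<mu> (matrix_inv \<Sigma>)"
  using spd_matrices_invertible[OF assms]
  by (intro matrix_inv_eqI normal_embed_mult_precision_embed) (rule matrix_inv_right)

text \<open>The same product identity, with \<open>matrix_inv A\<close> as covariance and the two
  factors swapped.\<close>

lemma matrix_inv_precision_embed:
  assumes "A \<in> spd_matrices"
  shows "matrix_inv (precision_embed \<mu> A) = normal_embed (\<mu>, matrix_inv A)"
  using spd_matrices_invertible[OF assms]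
  by (metis matrix_inv_eqI matrix_inv_left matrix_left_right_inverse
      normal_embed_mult_precision_embed)

text \<open>The outer product of the mean subtracted in the mixture covariance is exactly what
  \<open>normal_embed\<close> adds back.\<close>

lemma normal_embed_mixture_geodesic:
  "normal_embed (mixture_geodesic N1 N2 t) =
    cone_mixture_geodesic (normal_embed N1) (normal_embed N2) t"
  by (auto simp: normal_embed_def mixture_geodesic_def cone_mixture_geodesic_def Let_def
      vec_eq_iff algebra_simps split: prod.splits sum.splits)

lemma normal_embed_exponential_geodesic:
  assumes "\<Sigma>1 \<in> spd_matrices" "\<Sigma>2 \<in> spd_matrices" "t \<in> {0..1}"
  shows "normal_embed (exponential_geodesic (\<mu>, \<Sigma>1) (\<mu>, \<Sigma>2) t) =
    cone_exponential_geodesic (normal_embed (\<mu>, \<Sigma>1)) (normal_embed (\<mu>, \<Sigma>2)) t"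
proof -
  define A where "A = t *\<^sub>R matrix_inv \<Sigma>1 + (1 - t) *\<^sub>R matrix_inv \<Sigma>2"
  have A: "A \<in> spd_matrices"
    using assms unfolding A_def
    by (intro convexD[OF spd_matrices_convex] spd_matrices_matrix_inv) auto
  \<comment> \<open>With a common mean, the interpolated natural parameter factors as
    \<open>A *v \<mu>\<close>, so the curve keeps the mean \<open>\<mu>\<close>.\<close>
  have "matrix_inv A *v (t *\<^sub>R (matrix_inv \<Sigma>1 *v \<mu>) + (1 - t) *\<^sub>R (matrix_inv \<Sigma>2 *v \<mu>)) =
      matrix_inv A *v (A *v \<mu>)"
    by (simp add: A_def matrix_vector_mult_add_rdistrib scaleR_matrix_vector_assoc)
  also have "\<dots> = \<mu>"
    using spd_matrices_invertible[OF A] by (simp add: matrix_vector_mul_assoc matrix_inv_left)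
  finally have "exponential_geodesic (\<mu>, \<Sigma>1) (\<mu>, \<Sigma>2) t = (\<mu>, matrix_inv A)"
    by (simp add: exponential_geodesic_def Let_def A_def)
  \<comment> \<open>Both sides equal the inverse of \<open>precision_embed \<mu> A\<close>.\<close>
  then show ?thesis
    using matrix_inv_precision_embed[OF A]
    by (simp add: cone_exponential_geodesic_def matrix_inv_normal_embed assms A_def
        precision_embed_affine)
qed

theorem proposition5:
  shows "(\<forall>N1 \<in> (normal_params :: ((real^'n) \<times> (real^'n^'n)) set). \<forall>N2 \<in> normal_params. \<forall>t \<in> {0..1}.
      normal_embed (mixture_geodesic N1 N2 t) = cone_mixture_geodesic (normal_embed N1) (normal_embed N2) t) \<and>
    (\<forall>(\<mu> :: real^'n) \<Sigma>1 \<Sigma>2. (\<mu>, \<Sigma>1) \<in> normal_params \<longrightarrow> (\<mu>, \<Sigma>2) \<in> normal_params \<longrightarrow>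
      (\<forall>t \<in> {0..1}. normal_embed (exponential_geodesic (\<mu>, \<Sigma>1) (\<mu>, \<Sigma>2) t) =
        cone_exponential_geodesic (normal_embed (\<mu>, \<Sigma>1)) (normal_embed (\<mu>, \<Sigma>2)) t))"
  by (simp add: normal_embed_mixture_geodesic normal_embed_exponential_geodesic normal_params_def)

end
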